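(* Let $\mathcal{H}$ be a real finite-dimensional Hilbert space and $A$ a self-adjoint positive definite (SPD) linear operator on $\mathcal{H}$. Let $J\ge1$, let $\mathcal{H}_k$, $k=0,1,\ldots,J$, be real finite-dimensional Hilbert spaces, and let $I_k:\mathcal{H}_k\to\mathcal{H}$ and $I^k:\mathcal{H}\to\mathcal{H}_k$, $k=0,\ldots,J$, be linear operators such that $\mathrm{null}(I_k)=\{0\}$ for $k=1,\ldots,J$ and $\mathcal{H}=\sum_{k=1}^J I_k\mathcal{H}_k$. Let $R_k$ be a linear operator on $\mathcal{H}_k$, $k=0,\ldots,J$, let $\omega>0$, and let $B$ be the additive domain decomposition operator on $\mathcal{H}$ defined by $$I - BA = I - \omega\,(I_0R_0I^0 + I_1R_1I^1+\cdots+I_JR_JI^J)A .$$ Suppose that 1. $I^k = c_k I_k^T$ with $c_k>0$, for $k=0,\ldots,J$; 2. $R_k$ is SPD on $\mathcal{H}_k$ for $k=1,\ldots,J$; 3. $R_0$ is symmetric (self-adjoint) and non-negative on $\mathcal{H}_0$. Then $B$ is self-adjoint and positive definite on $\mathcal{H}$.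
   Context: All inner products are written $(\cdot,\cdot)$; the inner products on the different spaces need not be related to each other. For a linear operator $N:\mathcal{H}_1'\to\mathcal{H}_2'$ between Hilbert spaces, $N^T:\mathcal{H}_2'\to\mathcal{H}_1'$ is the adjoint defined by $(Nu,v)_{\mathcal{H}_2'}=(u,N^Tv)_{\mathcal{H}_1'}$. An operator $M$ is positive definite if $(Mu,u)>0$ for all $u\ne0$, and non-negative if $(Mu,u)\ge0$ for all $u$; SPD means self-adjoint and positive definite. $I$ is the identity operator. *)

theory Defs
  imports Complex_Main "HOL-Library.Set_Algebras"
begin

text \<open>
  The statement concerns a family of Hilbert spaces indexed by a natural number, with dimensions
  and inner products that depend on the index.  A type-class inner product can express neither, so
  a Hilbert space is a pair of a carrier (a finite-dimensional linear subspace \<open>V\<close> of some real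
  vector space) and an inner product \<open>ip\<close>, of which only the values on \<open>V\<close> matter.
  Completeness is automatic in finite dimension, and \<open>V = {0}\<close> is allowed.
  Putting all carriers of the family into one ambient vector space is no restriction: any family
  of vector spaces embeds into its direct sum, and the inner products stay unrelated.
  Operators are functions of which only the values on the carrier matter.
\<close>

definition fin_dim_hilbert :: "'a::real_vector set \<Rightarrow> ('a \<Rightarrow> 'a \<Rightarrow> real) \<Rightarrow> bool" where
  "fin_dim_hilbert V ip \<longleftrightarrow>
     (\<exists>S. finite S \<and> span S = V) \<and>
     (\<forall>x\<in>V. \<forall>y\<in>V. ip x y = ip y x) \<and>
     (\<forall>x\<in>V. \<forall>y\<in>V. \<forall>z\<in>V. ip (x + y) z = ip x z + ip y z) \<and>
     (\<forall>a. \<forall>x\<in>V. \<forall>y\<in>V. ip (a *\<^sub>R x) y = a * ip x y) \<and>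
     (\<forall>x\<in>V. x \<noteq> 0 \<longrightarrow> 0 < ip x x)"

definition linear_op :: "'a::real_vector set \<Rightarrow> 'b::real_vector set \<Rightarrow> ('a \<Rightarrow> 'b) \<Rightarrow> bool" where
  "linear_op V W N \<longleftrightarrow>
     (\<forall>x\<in>V. N x \<in> W) \<and>
     (\<forall>x\<in>V. \<forall>y\<in>V. N (x + y) = N x + N y) \<and>
     (\<forall>a. \<forall>x\<in>V. N (a *\<^sub>R x) = a *\<^sub>R N x)"

definition null_space :: "'a::real_vector set \<Rightarrow> ('a \<Rightarrow> 'b::real_vector) \<Rightarrow> 'a set" where
  "null_space V N = {x \<in> V. N x = 0}"

text \<open>The adjoint \<open>W \<rightarrow> V\<close> of \<open>N : V \<rightarrow> W\<close>; the lemma \<open>adjoint_op_works\<close> below shows that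
  the definite description is well-defined on \<open>W\<close>.\<close>

definition adjoint_op ::
  "'a::real_vector set \<Rightarrow> ('a \<Rightarrow> 'a \<Rightarrow> real) \<Rightarrow> ('b::real_vector \<Rightarrow> 'b \<Rightarrow> real) \<Rightarrow> ('a \<Rightarrow> 'b) \<Rightarrow> 'b \<Rightarrow> 'a" where
  "adjoint_op V ipV ipW N v = (THE w. w \<in> V \<and> (\<forall>u\<in>V. ipW (N u) v = ipV u w))"

definition self_adjoint :: "'a::real_vector set \<Rightarrow> ('a \<Rightarrow> 'a \<Rightarrow> real) \<Rightarrow> ('a \<Rightarrow> 'a) \<Rightarrow> bool" where
  "self_adjoint V ip M \<longleftrightarrow> (\<forall>u\<in>V. \<forall>v\<in>V. ip (M u) v = ip u (M v))"

definition positive_definite :: "'a::real_vector set \<Rightarrow> ('a \<Rightarrow> 'a \<Rightarrow> real) \<Rightarrow> ('a \<Rightarrow> 'a) \<Rightarrow> bool" where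
  "positive_definite V ip M \<longleftrightarrow> (\<forall>u\<in>V. u \<noteq> 0 \<longrightarrow> 0 < ip (M u) u)"

definition non_negative :: "'a::real_vector set \<Rightarrow> ('a \<Rightarrow> 'a \<Rightarrow> real) \<Rightarrow> ('a \<Rightarrow> 'a) \<Rightarrow> bool" where
  "non_negative V ip M \<longleftrightarrow> (\<forall>u\<in>V. 0 \<le> ip (M u) u)"

definition SPD :: "'a::real_vector set \<Rightarrow> ('a \<Rightarrow> 'a \<Rightarrow> real) \<Rightarrow> ('a \<Rightarrow> 'a) \<Rightarrow> bool" where
  "SPD V ip M \<longleftrightarrow> self_adjoint V ip M \<and> positive_definite V ip M"

lemma fin_dim_hilbert_subspace: "fin_dim_hilbert V ip \<Longrightarrow> subspace V"
  unfolding fin_dim_hilbert_def using subspace_span by blast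

lemma fin_dim_hilbertD:
  assumes "fin_dim_hilbert V ip"
  shows "\<And>x y. x \<in> V \<Longrightarrow> y \<in> V \<Longrightarrow> ip x y = ip y x"
    and "\<And>x y z. x \<in> V \<Longrightarrow> y \<in> V \<Longrightarrow> z \<in> V \<Longrightarrow> ip (x + y) z = ip x z + ip y z"
    and "\<And>a x y. x \<in> V \<Longrightarrow> y \<in> V \<Longrightarrow> ip (a *\<^sub>R x) y = a * ip x y"
    and "\<And>x. x \<in> V \<Longrightarrow> x \<noteq> 0 \<Longrightarrow> 0 < ip x x"
    and "\<And>x y z. x \<in> V \<Longrightarrow> y \<in> V \<Longrightarrow> z \<in> V \<Longrightarrow> ip x (y + z) = ip x y + ip x z"
    and "\<And>a x y. x \<in> V \<Longrightarrow> y \<in> V \<Longrightarrow> ip x (a *\<^sub>R y) = a * ip x y"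
proof -
  note * = assms[unfolded fin_dim_hilbert_def]
  have sub: "subspace V" by (rule fin_dim_hilbert_subspace[OF assms])
  show c: "ip x y = ip y x" if "x \<in> V" "y \<in> V" for x y using * that by blast
  show p: "ip (x + y) z = ip x z + ip y z" if "x \<in> V" "y \<in> V" "z \<in> V" for x y z
    using * that by blast
  show s: "ip (a *\<^sub>R x) y = a * ip x y" if "x \<in> V" "y \<in> V" for a x y using * that by blast
  show "0 < ip x x" if "x \<in> V" "x \<noteq> 0" for x using * that by blast
  show "ip x (y + z) = ip x y + ip x z" if "x \<in> V" "y \<in> V" "z \<in> V" for x y z
    using c p that subspace_add[OF sub] by metis
  show "ip x (a *\<^sub>R y) = a * ip x y" if "x \<in> V" "y \<in> V" for a x y
    using c s that subspace_scale[OF sub] by metis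
qed

lemma fin_dim_riesz:
  assumes "finite S" "fin_dim_hilbert V ip" "span S \<subseteq> V"
    and "\<And>x y. x \<in> V \<Longrightarrow> y \<in> V \<Longrightarrow> \<phi> (x + y) = \<phi> x + \<phi> y"
    and "\<And>a x. x \<in> V \<Longrightarrow> \<phi> (a *\<^sub>R x) = a * \<phi> x"
  shows "\<exists>w\<in>span S. \<forall>u\<in>span S. (\<phi> u :: real) = ip u w"
  using assms
proof (induction S arbitrary: \<phi> rule: finite_induct)
  case empty
  have z: "0 \<in> V" using empty(2) by auto
  have "\<phi> 0 = 0" using empty(4)[OF z, of 0] by simp
  moreover have "ip 0 0 = 0" using fin_dim_hilbertD(3)[OF empty(1) z z, of 0] by simp
  ultimately show ?case by simp
next
  case (insert b S)
  note H = fin_dim_hilbertD[OF insert.prems(1)]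
  have sub: "subspace V" by (rule fin_dim_hilbert_subspace[OF insert.prems(1)])
  have SV: "span S \<subseteq> V" using insert.prems(2) span_mono[of S "insert b S"] by blast
  have bV: "b \<in> V" using insert.prems(2) span_base[of b "insert b S"] by blast
  obtain w0 where w0: "w0 \<in> span S" "\<And>u. u \<in> span S \<Longrightarrow> \<phi> u = ip u w0"
    using insert.IH[OF insert.prems(1) SV insert.prems(3,4)] by blast
  obtain p where p: "p \<in> span S" "\<And>u. u \<in> span S \<Longrightarrow> ip u b = ip u p"
    using insert.IH[OF insert.prems(1) SV, of "\<lambda>u. ip u b"] H(2,3) bV by metis
  define n where "n = b - p"
  have nV: "n \<in> V" using p SV bV subspace_diff[OF sub] unfolding n_def by blast
  have w0V: "w0 \<in> V" using w0 SV by blast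
  have orth: "ip u n = 0" if "u \<in> span S" for u
  proof -
    have uV: "u \<in> V" using that SV by blast
    have "ip u b = ip u (n + p)" by (simp add: n_def)
    also have "\<dots> = ip u n + ip u p" using H(5) uV nV p SV by blast
    finally show ?thesis using p(2)[OF that] by simp
  qed
  define t where "t = \<phi> n / ip n n"
  have tn: "t * ip n n = \<phi> n"
  proof (cases "n = 0")
    case True
    then show ?thesis using insert.prems(4)[OF nV, of 0] nV H(3)[OF nV nV, of 0] by simp
  next
    case False
    then show ?thesis using H(4)[OF nV] by (simp add: t_def)
  qed
  define w where "w = w0 + t *\<^sub>R n"
  have "p \<in> span (insert b S)" "w0 \<in> span (insert b S)" "b \<in> span (insert b S)"
    using p w0 span_mono[of S "insert b S"] span_base[of b "insert b S"] by blast+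
  then have "w \<in> span (insert b S)"
    unfolding w_def n_def by (intro span_add span_scale span_diff)
  moreover have "\<phi> u = ip u w" if u: "u \<in> span (insert b S)" for u
  proof -
    obtain k where k: "u - k *\<^sub>R b \<in> span S" using u span_breakdown_eq by blast
    define s where "s = (u - k *\<^sub>R b) + k *\<^sub>R p"
    have s: "s \<in> span S" unfolding s_def using k p by (intro span_add span_scale)
    then have sV: "s \<in> V" using SV by blast
    have knV: "k *\<^sub>R n \<in> V" and tnV: "t *\<^sub>R n \<in> V" using nV subspace_scale[OF sub] by blast+
    have u_eq: "u = k *\<^sub>R n + s" by (simp add: s_def n_def algebra_simps)
    have wV: "w \<in> V" unfolding w_def using w0V tnV subspace_add[OF sub] by blast
    have "ip n w0 = 0" using orth[OF w0(1)] H(1)[OF nV w0V] by simp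
    then have nw: "ip n w = \<phi> n"
      unfolding w_def using H(5)[OF nV w0V tnV] H(6)[OF nV nV, of t] tn by simp
    have sw: "ip s w = \<phi> s"
      unfolding w_def using H(5)[OF sV w0V tnV] H(6)[OF sV nV, of t] orth[OF s] w0(2)[OF s] by simp
    have "\<phi> u = k * \<phi> n + \<phi> s"
      unfolding u_eq using insert.prems(3)[OF knV sV] insert.prems(4)[OF nV, of k] by simp
    moreover have "ip u w = k * ip n w + ip s w"
      unfolding u_eq using H(2)[OF knV sV wV] H(3)[OF nV wV, of k] by simp
    ultimately show ?thesis using nw sw by simp
  qed
  ultimately show ?case by blast
qed

lemma adjoint_op_works:
  assumes V: "fin_dim_hilbert V ipV" and W: "fin_dim_hilbert W ipW"
    and N: "linear_op V W N" and v: "v \<in> W"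
  shows "adjoint_op V ipV ipW N v \<in> V"
    and "\<And>u. u \<in> V \<Longrightarrow> ipW (N u) v = ipV u (adjoint_op V ipV ipW N v)"
proof -
  note HV = fin_dim_hilbertD[OF V] and HW = fin_dim_hilbertD[OF W]
  have sub: "subspace V" by (rule fin_dim_hilbert_subspace[OF V])
  obtain S where S: "finite S" "span S = V" using V unfolding fin_dim_hilbert_def by blast
  have "\<exists>w\<in>span S. \<forall>u\<in>span S. ipW (N u) v = ipV u w"
    using N v S HW(2,3) by (intro fin_dim_riesz[OF S(1) V]) (auto simp: linear_op_def)
  then obtain w where w: "w \<in> V" "\<forall>u\<in>V. ipW (N u) v = ipV u w" using S by blast
  have "w' = w" if w': "w' \<in> V" "\<forall>u\<in>V. ipW (N u) v = ipV u w'" for w'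
  proof (rule ccontr)
    assume "w' \<noteq> w"
    have d: "w' - w \<in> V" using w w' subspace_diff[OF sub] by blast
    have "ipV (w' - w) w' = ipV (w' - w) ((w' - w) + w)" by simp
    also have "\<dots> = ipV (w' - w) (w' - w) + ipV (w' - w) w" using HV(5)[OF d d w(1)] .
    finally have "ipV (w' - w) (w' - w) = 0" using w w' d by simp
    then show False using HV(4)[OF d] \<open>w' \<noteq> w\<close> by simp
  qed
  then have "\<exists>!w. w \<in> V \<and> (\<forall>u\<in>V. ipW (N u) v = ipV u w)" using w by blast
  from theI'[OF this]
  show "adjoint_op V ipV ipW N v \<in> V"
    and "\<And>u. u \<in> V \<Longrightarrow> ipW (N u) v = ipV u (adjoint_op V ipV ipW N v)"
    unfolding adjoint_op_def by blast+
qed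

end

theory Submission
  imports Defs
begin

text \<open>
  Since \<open>A\<close> is SPD, it maps \<open>H\<close> onto itself, so the relation that defines \<open>B A\<close> determines
  \<open>B\<close> on all of \<open>H\<close>: \<open>B = \<omega> (\<Sum>k. I\<^sub>k R\<^sub>k I\<^sup>k)\<close>.  Writing \<open>T\<^sub>k\<close> for the adjoint
  of \<open>I\<^sub>k\<close> and using \<open>I\<^sup>k = c\<^sub>k T\<^sub>k\<close>, one gets
  \<open>(B u, v) = \<omega> (\<Sum>k. c\<^sub>k (R\<^sub>k T\<^sub>k u, T\<^sub>k v))\<close>.
  Every summand is a symmetric bilinear form in \<open>u, v\<close> and is non-negative on the diagonal, so
  \<open>B\<close> is self-adjoint and non-negative.  If \<open>(B u, u) = 0\<close>, every summand vanishes, hence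
  \<open>T\<^sub>k u = 0\<close> for all \<open>k \<ge> 1\<close>, where \<open>R\<^sub>k\<close> is definite.  Then \<open>u\<close> is orthogonal to the
  range of every \<open>I\<^sub>k\<close> with \<open>k \<ge> 1\<close>; these ranges add up to \<open>H\<close>, so \<open>u = 0\<close>.
\<close>

lemma fin_dim_hilbert_ip_sum:
  assumes V: "fin_dim_hilbert V ip" and f: "\<And>k. k \<in> K \<Longrightarrow> f k \<in> V" and w: "w \<in> V"
  shows "ip (sum f K) w = (\<Sum>k\<in>K. ip (f k) w)"
  using f
proof (induction K rule: infinite_finite_induct)
  case (insert k K)
  then have "sum f K \<in> V"
    by (intro subspace_sum[OF fin_dim_hilbert_subspace[OF V]]) simp
  with insert show ?case
    using fin_dim_hilbertD(2)[OF V] w by simp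
qed (use fin_dim_hilbertD(3)[OF V w w, of 0] fin_dim_hilbertD(3)[OF V _ w, of 0 0]
      subspace_0[OF fin_dim_hilbert_subspace[OF V]] in auto)

text \<open>
  The energy form \<open>(A u, v)\<close> is itself an inner product on \<open>V\<close>.  The Riesz representative \<open>w\<close> of
  \<open>u \<mapsto> (u, v)\<close> with respect to it satisfies \<open>(u, v) = (A u, w) = (u, A w)\<close> for all \<open>u\<close>, which
  forces \<open>v = A w\<close>.
\<close>

lemma SPD_surj:
  assumes V: "fin_dim_hilbert V ip" and A: "linear_op V V A" and spd: "SPD V ip A"
  shows "A ` V = V"
proof
  show "A ` V \<subseteq> V" using A by (auto simp: linear_op_def)
next
  note H = fin_dim_hilbertD[OF V]
  have AV: "A x \<in> V" if "x \<in> V" for x using A that by (auto simp: linear_op_def)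
  have sa: "ip (A x) y = ip x (A y)" if "x \<in> V" "y \<in> V" for x y
    using spd that by (auto simp: SPD_def self_adjoint_def)
  obtain S where S: "finite S" "span S = V" using V unfolding fin_dim_hilbert_def by blast
  have "fin_dim_hilbert V (\<lambda>x y. ip (A x) y)"
    unfolding fin_dim_hilbert_def
  proof (intro conjI ballI allI impI)
    show "\<exists>S. finite S \<and> span S = V" using S by blast
    show "ip (A x) y = ip (A y) x" if "x \<in> V" "y \<in> V" for x y
      using sa H(1) AV that by metis
    show "ip (A (x + y)) z = ip (A x) z + ip (A y) z" if "x \<in> V" "y \<in> V" "z \<in> V" for x y z
      using A H(2) that by (simp add: linear_op_def)
    show "ip (A (a *\<^sub>R x)) y = a * ip (A x) y" if "x \<in> V" "y \<in> V" for a x y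
      using A H(3) that by (simp add: linear_op_def)
    show "0 < ip (A x) x" if "x \<in> V" "x \<noteq> 0" for x
      using spd that by (auto simp: SPD_def positive_definite_def)
  qed
  note riesz = fin_dim_riesz[OF S(1) this]
  show "V \<subseteq> A ` V"
  proof
    fix v assume v: "v \<in> V"
    obtain w where w: "w \<in> V" "\<And>u. u \<in> V \<Longrightarrow> ip u v = ip (A u) w"
      using riesz[of "\<lambda>u. ip u v"] S H(2,3) v by auto
    define n where "n = v - A w"
    have n: "n \<in> V"
      unfolding n_def using v AV[OF w(1)] subspace_diff[OF fin_dim_hilbert_subspace[OF V]] by blast
    have "ip n v = ip n n + ip n (A w)"
      using H(5)[OF n n AV[OF w(1)]] by (simp add: n_def)
    then have "ip n n = 0" using w(2)[OF n] sa[OF n w(1)] by simp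
    then have "n = 0" using H(4)[OF n] by force
    then show "v \<in> A ` V" using w(1) by (simp add: n_def)
  qed
qed

text \<open>
  The contribution of one level: moving \<open>N\<close> across the inner product turns \<open>N R (c N\<^sup>T)\<close> into the
  pull-back under \<open>N\<^sup>T\<close> of the form of \<open>R\<close>, from which it inherits symmetry and sign.
\<close>

lemma ip_conjugate_adjoint_op:
  assumes V: "fin_dim_hilbert V ipV" and W: "fin_dim_hilbert W ipW"
    and N: "linear_op V W N" and R: "linear_op V V R" and u: "u \<in> W" and v: "v \<in> W"
  defines "T \<equiv> adjoint_op V ipV ipW N"
  shows "ipW (N (R (c *\<^sub>R T u))) v = c * ipV (R (T u)) (T v)"
proof -
  have T: "T u \<in> V" "T v \<in> V"
    unfolding T_def using adjoint_op_works(1)[OF V W N] u v by blast+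
  then have RT: "R (T u) \<in> V" using R by (auto simp: linear_op_def)
  have "R (c *\<^sub>R T u) = c *\<^sub>R R (T u)" using R T by (auto simp: linear_op_def)
  moreover have "c *\<^sub>R R (T u) \<in> V"
    using RT subspace_scale[OF fin_dim_hilbert_subspace[OF V]] by blast
  ultimately have "ipW (N (R (c *\<^sub>R T u))) v = ipV (c *\<^sub>R R (T u)) (T v)"
    unfolding T_def using adjoint_op_works(2)[OF V W N v] by simp
  then show ?thesis using fin_dim_hilbertD(3)[OF V RT T(2)] by simp
qed

text \<open>
  Expanding the first argument of \<open>(u, u)\<close> along \<open>u = \<Sum>k. N\<^sub>k h\<^sub>k\<close> gives
  \<open>(u, u) = \<Sum>k. (h\<^sub>k, N\<^sub>k\<^sup>T u)\<close>, so the adjoints cannot all vanish at a nonzero \<open>u\<close>.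
\<close>

lemma adjoint_ops_nonzero:
  assumes W: "fin_dim_hilbert W ip" and K: "finite K"
    and V: "\<And>k. k \<in> K \<Longrightarrow> fin_dim_hilbert (V k) (ipV k)"
    and N: "\<And>k. k \<in> K \<Longrightarrow> linear_op (V k) W (N k)"
    and cover: "W = (\<Sum>k\<in>K. N k ` V k)" and u: "u \<in> W" "u \<noteq> 0"
  shows "\<exists>k\<in>K. adjoint_op (V k) (ipV k) ip (N k) u \<noteq> 0"
proof (rule ccontr)
  assume "\<not> ?thesis"
  then have zero: "adjoint_op (V k) (ipV k) ip (N k) u = 0" if "k \<in> K" for k
    using that by blast
  have "u \<in> (\<Sum>k\<in>K. N k ` V k)" using u(1) cover by simp
  then obtain s where s: "u = sum s K" "\<And>k. k \<in> K \<Longrightarrow> s k \<in> N k ` V k"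
    unfolding set_sum_alt[OF K] by blast
  have sW: "s k \<in> W" if "k \<in> K" for k
    using s(2)[OF that] N[OF that] by (auto simp: linear_op_def)
  have "ip (s k) u = 0" if k: "k \<in> K" for k
  proof -
    obtain h where h: "h \<in> V k" "s k = N k h" using s(2)[OF k] by blast
    have "ip (s k) u = ipV k h 0"
      using adjoint_op_works(2)[OF V[OF k] W N[OF k] u(1) h(1)] zero[OF k] h(2) by simp
    also have "\<dots> = 0" using fin_dim_hilbertD(6)[OF V[OF k] h(1) h(1), of 0] by simp
    finally show ?thesis .
  qed
  moreover have "ip u u = (\<Sum>k\<in>K. ip (s k) u)"
    using fin_dim_hilbert_ip_sum[OF W sW u(1)] s(1) by simp
  ultimately have "ip u u = 0" by simp
  then show False using fin_dim_hilbertD(4)[OF W u] by simp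
qed

theorem theorem4p4:
  fixes H :: "'a::real_vector set" and ip :: "'a \<Rightarrow> 'a \<Rightarrow> real"
    and Hk :: "nat \<Rightarrow> 'b::real_vector set" and ipk :: "nat \<Rightarrow> 'b \<Rightarrow> 'b \<Rightarrow> real"
    and A B :: "'a \<Rightarrow> 'a"
    and I_low :: "nat \<Rightarrow> 'b \<Rightarrow> 'a" and I_up :: "nat \<Rightarrow> 'a \<Rightarrow> 'b"
    and R :: "nat \<Rightarrow> 'b \<Rightarrow> 'b"
    and c :: "nat \<Rightarrow> real" and \<omega> :: real and J :: nat
  assumes "fin_dim_hilbert H ip"
    and "linear_op H H A" and "SPD H ip A"
    and "J \<ge> 1"
    and "\<And>k. k \<in> {0..J} \<Longrightarrow> fin_dim_hilbert (Hk k) (ipk k)"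
    and "\<And>k. k \<in> {0..J} \<Longrightarrow> linear_op (Hk k) H (I_low k)"
    and "\<And>k. k \<in> {0..J} \<Longrightarrow> linear_op H (Hk k) (I_up k)"
    and "\<And>k. k \<in> {1..J} \<Longrightarrow> null_space (Hk k) (I_low k) = {0}"
    and "H = (\<Sum>k=1..J. I_low k ` Hk k)"
    and "\<And>k. k \<in> {0..J} \<Longrightarrow> linear_op (Hk k) (Hk k) (R k)"
    and "\<omega> > 0"
    and "linear_op H H B"
    and "\<And>u. u \<in> H \<Longrightarrow>
           u - B (A u) = u - \<omega> *\<^sub>R (\<Sum>k=0..J. I_low k (R k (I_up k (A u))))"
    and "\<And>k. k \<in> {0..J} \<Longrightarrow> c k > 0"
    and "\<And>k v. k \<in> {0..J} \<Longrightarrow> v \<in> H \<Longrightarrow>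
           I_up k v = c k *\<^sub>R adjoint_op (Hk k) (ipk k) ip (I_low k) v"
    and "\<And>k. k \<in> {1..J} \<Longrightarrow> SPD (Hk k) (ipk k) (R k)"
    and "self_adjoint (Hk 0) (ipk 0) (R 0)" and "non_negative (Hk 0) (ipk 0) (R 0)"
  shows "self_adjoint H ip B \<and> positive_definite H ip B"
proof -
  note H = assms(1) and Hk = assms(5) and N = assms(6) and lin_R = assms(10)
  define T where "T k = adjoint_op (Hk k) (ipk k) ip (I_low k)" for k
  define b where "b k u v = ipk k (R k (T k u)) (T k v)" for k u v
  have T: "T k u \<in> Hk k" if "k \<in> {0..J}" "u \<in> H" for k u
    unfolding T_def using adjoint_op_works(1)[OF Hk H N] that by blast
  have B_eq: "B v = \<omega> *\<^sub>R (\<Sum>k=0..J. I_low k (R k (I_up k v)))" if "v \<in> H" for v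
  proof -
    have "v \<in> A ` H" using SPD_surj[OF assms(1-3)] that by simp
    then obtain u where u: "u \<in> H" "v = A u" by blast
    show ?thesis using assms(13)[OF u(1)] unfolding u(2) by simp
  qed
  have form: "ip (B u) v = \<omega> * (\<Sum>k=0..J. c k * b k u v)" if u: "u \<in> H" and v: "v \<in> H" for u v
  proof -
    have in_H: "I_low k (R k (I_up k u)) \<in> H" if "k \<in> {0..J}" for k
      using N[OF that] lin_R[OF that] assms(7)[OF that] u by (simp add: linear_op_def)
    have "ip (B u) v = \<omega> * ip (\<Sum>k=0..J. I_low k (R k (I_up k u))) v"
      unfolding B_eq[OF u]
      by (intro fin_dim_hilbertD(3)[OF H _ v] subspace_sum[OF fin_dim_hilbert_subspace[OF H]] in_H)
    also have "ip (\<Sum>k=0..J. I_low k (R k (I_up k u))) v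
        = (\<Sum>k=0..J. ip (I_low k (R k (I_up k u))) v)"
      by (rule fin_dim_hilbert_ip_sum[OF H in_H v])
    also have "\<dots> = (\<Sum>k=0..J. c k * b k u v)"
    proof (rule sum.cong)
      fix k assume k: "k \<in> {0..J}"
      show "ip (I_low k (R k (I_up k u))) v = c k * b k u v"
        unfolding assms(15)[OF k u] b_def T_def
        by (rule ip_conjugate_adjoint_op[OF Hk[OF k] H N[OF k] lin_R[OF k] u v])
    qed simp
    finally show ?thesis .
  qed
  have b_sym: "b k u v = b k v u" if k: "k \<in> {0..J}" and u: "u \<in> H" and v: "v \<in> H" for k u v
  proof -
    have "self_adjoint (Hk k) (ipk k) (R k)"
      using assms(16)[of k] assms(17) k by (cases "k = 0") (auto simp: SPD_def)
    then have "b k u v = ipk k (T k u) (R k (T k v))"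
      using T[OF k] u v by (simp add: b_def self_adjoint_def)
    also have "\<dots> = b k v u"
      unfolding b_def using lin_R[OF k] T[OF k] u v
      by (intro fin_dim_hilbertD(1)[OF Hk[OF k]]) (auto simp: linear_op_def)
    finally show ?thesis .
  qed
  have b_pos: "0 < b k u u" if "k \<in> {1..J}" "u \<in> H" "T k u \<noteq> 0" for k u
    using assms(16)[OF that(1)] T[of k u] that by (auto simp: b_def SPD_def positive_definite_def)
  have b_nonneg: "0 \<le> b k u u" if k: "k \<in> {0..J}" and u: "u \<in> H" for k u
  proof -
    consider "k = 0" | "k \<in> {1..J}" "T k u \<noteq> 0" | "T k u = 0" using k by force
    then show ?thesis
    proof cases
      case 1
      then show ?thesis using assms(18) T[OF k u] by (simp add: b_def non_negative_def)
    next
      case 2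
      then show ?thesis using b_pos u by force
    next
      case 3
      have "R k 0 \<in> Hk k" using lin_R[OF k] T[OF k u] 3 by (simp add: linear_op_def)
      then show ?thesis
        using 3 fin_dim_hilbertD(6)[OF Hk[OF k], of "R k 0" "R k 0" 0] by (simp add: b_def)
    qed
  qed
  have "self_adjoint H ip B"
    unfolding self_adjoint_def
  proof (intro ballI)
    fix u v assume u: "u \<in> H" and v: "v \<in> H"
    have "B v \<in> H" using assms(12) v by (simp add: linear_op_def)
    then have "ip u (B v) = ip (B v) u" using fin_dim_hilbertD(1)[OF H] u by blast
    also have "\<dots> = ip (B u) v"
      unfolding form[OF u v] form[OF v u] using b_sym u v by simp
    finally show "ip (B u) v = ip u (B v)" by simp
  qed
  moreover have "positive_definite H ip B"
    unfolding positive_definite_def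
  proof (intro ballI impI)
    fix u assume u: "u \<in> H" "u \<noteq> 0"
    obtain k where k: "k \<in> {1..J}" "T k u \<noteq> 0"
      using adjoint_ops_nonzero[OF H _ _ _ assms(9) u, of ipk] Hk N unfolding T_def by auto
    have "0 < (\<Sum>k=0..J. c k * b k u u)"
    proof (rule sum_pos2[of _ k])
      show "0 < c k * b k u u" using assms(14)[of k] b_pos[OF k(1) u(1) k(2)] k(1) by simp
      show "0 \<le> c j * b j u u" if "j \<in> {0..J}" for j
        using assms(14)[OF that] b_nonneg[OF that u(1)] by simp
    qed (use k(1) in auto)
    then show "0 < ip (B u) u" unfolding form[OF u(1) u(1)] using assms(11) by simp
  qed
  ultimately show ?thesis ..
qed

end
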